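(* Let $K=2^{\mathbb{N}}$, let $\mu$ be the uniform (fair-coin product) probability measure on $K$, and let $\mathrm{Aut}(K,\mu)$ be the group of all homeomorphisms of $K$ that preserve $\mu$. Then $\mathrm{Aut}(K,\mu)$ is a closed proper subgroup of $\mathrm{Homeo}(K)$, and there are no purely direct relational language $\mathcal{L}$ and purely direct topological $\mathcal{L}$-structure $\mathbf{K}$ with domain $K$ such that $\mathrm{Aut}(\mathbf{K})=\mathrm{Aut}(K,\mu)$.
   Context: $\mathrm{Homeo}(K)$ carries the compact-open topology. For $n>0$, $K^{[n]}$ denotes the set of injections $\{0,\dots,n-1\}\to K$ (direct tuples of size $n$), with the topology inherited from $K^n$. A purely direct relational language $\mathcal{L}$ is a set of relation symbols, each with a positive arity. A purely direct topological $\mathcal{L}$-structure $\mathbf{K}$ is a zero-dimensional, compact, metrizable space $K$ together with, for each $r\in\mathcal{L}$ of arity $n$, a closed subset $r^{\mathbf{K}}$ of $K^{[n]}$. An *epimorphism* $f\colon\mathbf{A}\to\mathbf{B}$ of purely direct topological $\mathcal{L}$-structures is a continuous surjection $f\colon A\to B$ such that for every $r\in\mathcal{L}$ of arity $m$ and every $\beta\in B^{[m]}$, $\beta\in r^{\mathbf{B}}$ iff there is $\alpha\in r^{\mathbf{A}}$ with $\beta=f\circ\alpha$. An automorphism of $\mathbf{A}$ is a bijective epimorphism from $\mathbf{A}$ to $\mathbf{A}$, and $\mathrm{Aut}(\mathbf{A})\le\mathrm{Homeo}(A)$ is the group of automorphisms. *)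

theory Defs
  imports "HOL-Probability.Probability" "HOL-Algebra.Bij"
begin

text \<open>As in the library's \<open>BijGroup\<close>, self-maps of a space are made extensional, so that equality
  of functions is equality on the space. The underlying set of the space is \<open>topspace X\<close>.\<close>

definition Homeo :: "'a topology \<Rightarrow> ('a \<Rightarrow> 'a) set" where
  "Homeo X = {h \<in> extensional (topspace X). homeomorphic_map X X h}"

definition homeo_group :: "'a topology \<Rightarrow> ('a \<Rightarrow> 'a) monoid" where
  "homeo_group X = (BijGroup (topspace X))\<lparr>carrier := Homeo X\<rparr>"

definition homeo_topology :: "'a topology \<Rightarrow> ('a \<Rightarrow> 'a) topology" where
  "homeo_topology X =
    topology_generated_by {{h \<in> Homeo X. h ` C \<subseteq> U} | C U. compactin X C \<and> openin X U}"

lemma topspace_homeo_topology: "topspace (homeo_topology X) = Homeo X"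
proof -
  have "Homeo X \<in> {{h \<in> Homeo X. h ` C \<subseteq> U} | C U. compactin X C \<and> openin X U}"
    by (rule CollectI, rule exI[of _ "{}"], rule exI[of _ "{}"]) auto
  then show ?thesis
    unfolding homeo_topology_def topology_generated_by_topspace by blast
qed

lemma subgroup_Homeo: "subgroup (Homeo X) (BijGroup (topspace X))"
proof -
  interpret G: group "BijGroup (topspace X)" by (rule group_BijGroup)
  have Bij: "h \<in> Bij (topspace X)" if "h \<in> Homeo X" for h
    using that by (auto simp: Homeo_def Bij_def bij_betw_def homeomorphic_imp_injective_map
        homeomorphic_imp_surjective_map)
  show ?thesis
  proof (rule G.subgroupI)
    show "Homeo X \<subseteq> carrier (BijGroup (topspace X))"
      using Bij by (auto simp: BijGroup_def)
    have "homeomorphic_map X X (\<lambda>x\<in>topspace X. x)"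
      by (rule homeomorphic_map_eq[OF homeomorphic_map_id[THEN iffD2]]) auto
    then show "Homeo X \<noteq> {}"
      by (auto simp: Homeo_def)
  next
    fix h assume h: "h \<in> Homeo X"
    then obtain g where g: "homeomorphic_maps X X h g"
      by (auto simp: Homeo_def homeomorphic_map_maps)
    have eq: "inv_into (topspace X) h x = g x" if "x \<in> topspace X" for x
      using g that Bij[OF h]
      by (intro inv_into_f_eq) (auto simp: homeomorphic_maps_def Bij_def bij_betw_def
          continuous_map_def Pi_iff)
    have "homeomorphic_map X X g"
      using g homeomorphic_maps_map by blast
    then have "homeomorphic_map X X (\<lambda>x\<in>topspace X. inv_into (topspace X) h x)"
      by (rule homeomorphic_map_eq) (simp add: eq)
    then show "inv\<^bsub>BijGroup (topspace X)\<^esub> h \<in> Homeo X"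
      by (simp add: inv_BijGroup[OF Bij[OF h]] Homeo_def)
  next
    fix g h assume gh: "g \<in> Homeo X" "h \<in> Homeo X"
    have "homeomorphic_map X X (g \<circ> h)"
      using gh by (auto simp: Homeo_def intro: homeomorphic_map_compose)
    then have "homeomorphic_map X X (compose (topspace X) g h)"
      by (rule homeomorphic_map_eq) (simp add: compose_def)
    then show "g \<otimes>\<^bsub>BijGroup (topspace X)\<^esub> h \<in> Homeo X"
      using Bij gh by (simp add: BijGroup_def Homeo_def compose_def)
  qed
qed

lemma group_homeo_group: "group (homeo_group X)"
  unfolding homeo_group_def
  using group.subgroup_imp_group[OF group_BijGroup subgroup_Homeo] .

record 'r lang =
  symbols :: "'r set"
  arity :: "'r \<Rightarrow> nat"

definition purely_direct_lang :: "'r lang \<Rightarrow> bool" where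
  "purely_direct_lang L \<longleftrightarrow> (\<forall>r \<in> symbols L. 0 < arity L r)"

definition direct_tuples :: "nat \<Rightarrow> 'a set \<Rightarrow> (nat \<Rightarrow> 'a) set" where
  "direct_tuples n K = {\<alpha> \<in> {..<n} \<rightarrow>\<^sub>E K. inj_on \<alpha> {..<n}}"

definition direct_tuple_topology :: "nat \<Rightarrow> 'a topology \<Rightarrow> (nat \<Rightarrow> 'a) topology" where
  "direct_tuple_topology n X =
    subtopology (product_topology (\<lambda>_. X) {..<n}) (direct_tuples n (topspace X))"

record ('r, 'a) top_struct =
  dom_top :: "'a topology"
  interp :: "'r \<Rightarrow> (nat \<Rightarrow> 'a) set"

definition purely_direct_struct :: "'r lang \<Rightarrow> ('r, 'a) top_struct \<Rightarrow> bool" where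
  "purely_direct_struct L A \<longleftrightarrow>
    dom_top A dim_le 0 \<and> compact_space (dom_top A) \<and> metrizable_space (dom_top A) \<and>
    (\<forall>r \<in> symbols L. closedin (direct_tuple_topology (arity L r) (dom_top A)) (interp A r))"

text \<open>Here \<open>compose {..<n} f \<alpha>\<close> is the composite of \<open>f\<close> with the tuple \<open>\<alpha>\<close> of size \<open>n\<close>,
  as an extensional function on the indices.\<close>

definition epimorphism ::
  "'r lang \<Rightarrow> ('r, 'a) top_struct \<Rightarrow> ('r, 'b) top_struct \<Rightarrow> ('a \<Rightarrow> 'b) \<Rightarrow> bool" where
  "epimorphism L A B f \<longleftrightarrow>
    continuous_map (dom_top A) (dom_top B) f \<and>
    f ` topspace (dom_top A) = topspace (dom_top B) \<and>
    (\<forall>r \<in> symbols L. \<forall>\<beta> \<in> direct_tuples (arity L r) (topspace (dom_top B)).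
      \<beta> \<in> interp B r \<longleftrightarrow> (\<exists>\<alpha> \<in> interp A r. \<beta> = compose {..<arity L r} f \<alpha>))"

definition automorphisms :: "'r lang \<Rightarrow> ('r, 'a) top_struct \<Rightarrow> ('a \<Rightarrow> 'a) set" where
  "automorphisms L A =
    {f \<in> extensional (topspace (dom_top A)). epimorphism L A A f \<and>
      bij_betw f (topspace (dom_top A)) (topspace (dom_top A))}"

definition cantor_space :: "(nat \<Rightarrow> bool) topology" where
  "cantor_space = product_topology (\<lambda>_. discrete_topology UNIV) UNIV"

definition coin_measure :: "(nat \<Rightarrow> bool) measure" where
  "coin_measure = (\<Pi>\<^sub>M i\<in>UNIV. measure_pmf (bernoulli_pmf (1/2)))"

lemma topspace_cantor_space [simp]: "topspace cantor_space = UNIV"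
  by (simp add: cantor_space_def)

lemma cantor_space_eq_euclidean: "cantor_space = euclidean"
proof -
  have "discrete_topology (UNIV :: bool set) = euclidean"
    by (simp add: discrete_topology_unique Topological_Spaces.open_discrete)
  then show ?thesis
    by (simp add: cantor_space_def euclidean_product_topology)
qed

lemma space_coin_measure [simp]: "space coin_measure = UNIV"
  by (simp add: coin_measure_def space_PiM)

lemma prob_space_coin_measure: "prob_space coin_measure"
  unfolding coin_measure_def by (intro prob_space_PiM prob_space_measure_pmf)

instance bool :: second_countable_topology
proof
  have "open S = generate_topology (UNIV :: bool set set) S" for S :: "bool set"
    by (simp add: Topological_Spaces.open_discrete generate_topology.Basis)
  then show "\<exists>B::bool set set. countable B \<and> open = generate_topology B"
    by (intro exI[of _ UNIV]) (auto intro: countable_finite)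
qed

lemma sets_coin_measure: "sets coin_measure = sets borel"
proof -
  have "sets (measure_pmf (bernoulli_pmf (1/2))) = sets (borel :: bool measure)"
    by (simp add: sets_borel_eq_count_space)
  then have "sets coin_measure = sets (\<Pi>\<^sub>M i\<in>(UNIV::nat set). (borel :: bool measure))"
    unfolding coin_measure_def by (intro sets_PiM_cong) auto
  then show ?thesis
    by (simp add: sets_PiM_equal_borel)
qed

definition measure_automorphisms :: "'a topology \<Rightarrow> 'a measure \<Rightarrow> ('a \<Rightarrow> 'a) set" where
  "measure_automorphisms X M =
    {h \<in> Homeo X. \<forall>A \<in> sets M. emeasure M (h -` A \<inter> space M) = emeasure M A}"

end

(*
  A measure-preserving homeomorphism can exchange any two cylinders of the same length, and hence
  can move a tuple of distinct points arbitrarily close to any other such tuple. So the only closed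
  sets of direct n-tuples invariant under Aut(K, mu) are the empty set and K^[n]; a purely direct
  structure with these relations admits all of Homeo(K) as automorphisms. But Homeo(K) contains
  maps that do not preserve mu.
*)
theory Submission
  imports Defs
begin

section \<open>Clopen sets, continuous maps and measures on the Cantor space\<close>

text \<open>Each point of \<open>U\<close> has a basic open neighbourhood inside \<open>U\<close>,
  given by fixing its first \<open>m\<close> coordinates. The hypothesis passes to
  \<open>- U\<close>, so such sets are in fact clopen.\<close>

lemma open_finitely_determined:
  fixes U :: "(nat \<Rightarrow> 'b::discrete_topology) set"
  assumes "\<And>x y. x \<in> U \<Longrightarrow> (\<And>i. i < m \<Longrightarrow> y i = x i) \<Longrightarrow> y \<in> U"
  shows "open U"
proof (subst open_subopen, intro ballI)
  fix x assume x: "x \<in> U"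
  let ?V = "\<Inter>i<m. (\<lambda>y. y i) -` {x i}"
  have "open ?V"
    by (intro open_INT ballI finite_lessThan open_vimage Topological_Spaces.open_discrete
        continuous_on_product_coordinates)
  moreover have "?V \<subseteq> U"
    using assms[OF x] by auto
  ultimately show "\<exists>T. open T \<and> x \<in> T \<and> T \<subseteq> U"
    by (intro exI[of _ ?V]) auto
qed

lemma continuous_finitely_determined:
  fixes f :: "(nat \<Rightarrow> 'b::discrete_topology) \<Rightarrow> nat \<Rightarrow> 'c::topological_space"
  assumes "\<And>n x y. (\<And>i. i < m n \<Longrightarrow> y i = x i) \<Longrightarrow> f y n = f x n"
  shows "continuous_on UNIV f"
proof (rule continuous_on_coordinatewise_then_product)
  fix n
  have "open ((\<lambda>x. f x n) -` B)" for B
  proof (rule open_finitely_determined[where m = "m n"])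
    fix x y assume x: "x \<in> (\<lambda>x. f x n) -` B" and "\<And>i. i < m n \<Longrightarrow> y i = x i"
    from this(2) have "f y n = f x n" by (rule assms)
    with x show "y \<in> (\<lambda>x. f x n) -` B" by simp
  qed
  then show "continuous_on UNIV (\<lambda>x. f x n)"
    by (simp add: continuous_on_open_vimage)
qed

text \<open>The cylinders over finitely many coordinates determine a finite measure on the product,
  and they are clopen.\<close>

lemma coin_measure_eqI:
  assumes "sets M = sets coin_measure" "sets N = sets coin_measure" "finite_measure M"
    and eq: "\<And>U. open U \<Longrightarrow> closed U \<Longrightarrow> emeasure M U = emeasure N U"
  shows "M = N"
proof (rule measure_eqI_PiM_infinite[OF _ _ _ assms(3)])
  fix F :: "nat \<Rightarrow> bool set" and J :: "nat set"
  assume J: "finite J"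
  let ?E = "prod_emb UNIV (\<lambda>_. measure_pmf (bernoulli_pmf (1/2))) J (Pi\<^sub>E J F)"
  have E: "?E = {x. \<forall>j\<in>J. x j \<in> F j}"
    by (auto simp: prod_emb_def space_PiM)
  obtain m where m: "\<forall>j\<in>J. j < m"
    using J unfolding finite_nat_set_iff_bounded by blast
  have "open ?E" "open (- ?E)"
    unfolding E by (rule open_finitely_determined[where m = m]; use m in force)+
  then show "emeasure M ?E = emeasure N ?E"
    by (intro eq) (auto simp: closed_def)
qed (use assms in \<open>auto simp: coin_measure_def\<close>)

lemma Homeo_cantor_space:
  "h \<in> Homeo cantor_space \<longleftrightarrow>
    (\<exists>g. continuous_on UNIV h \<and> continuous_on UNIV g \<and> (\<forall>x. g (h x) = x) \<and> (\<forall>x. h (g x) = x))"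
  by (simp add: Homeo_def homeomorphic_map_maps homeomorphic_maps_def cantor_space_eq_euclidean)

lemma Homeo_cantor_spaceI:
  assumes "continuous_on UNIV h" "continuous_on UNIV g" "\<And>x. g (h x) = x" "\<And>x. h (g x) = x"
  shows "h \<in> Homeo cantor_space"
  using assms Homeo_cantor_space by blast

lemma Homeo_cantor_spaceD:
  assumes "h \<in> Homeo cantor_space"
  shows "continuous_on UNIV h" "bij h" "continuous_on UNIV (inv_into UNIV h)"
proof -
  obtain g where g: "continuous_on UNIV h" "continuous_on UNIV g"
      "\<forall>x. g (h x) = x" "\<forall>x. h (g x) = x"
    using assms Homeo_cantor_space by blast
  show "continuous_on UNIV h" by (fact g)
  show "bij h" using g by (metis bijI')
  have "inv_into UNIV h = g" using g by (intro inv_equality) auto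
  then show "continuous_on UNIV (inv_into UNIV h)" using g by simp
qed

lemma measurable_continuous_coin_measure:
  assumes "continuous_on UNIV h"
  shows "h \<in> coin_measure \<rightarrow>\<^sub>M coin_measure"
  using borel_measurable_continuous_onI[OF assms]
  by (simp cong: measurable_cong_sets add: sets_coin_measure)

section \<open>The measure-preserving homeomorphisms form a closed subgroup\<close>

abbreviation Aut_coin :: "((nat \<Rightarrow> bool) \<Rightarrow> nat \<Rightarrow> bool) set" where
  "Aut_coin \<equiv> measure_automorphisms cantor_space coin_measure"

lemma Aut_coinD:
  assumes "h \<in> Aut_coin" "A \<in> sets coin_measure"
  shows "emeasure coin_measure (h -` A) = emeasure coin_measure A"
  using assms by (auto simp: measure_automorphisms_def)

text \<open>The pushforward of the coin measure along \<open>h\<close> is determined by its values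
  on clopen sets. Testing on clopen sets is what makes closedness accessible: the preimage of a
  clopen set stays the same under small perturbations of \<open>h\<close>.\<close>

lemma Aut_coin_iff_clopen:
  "h \<in> Aut_coin \<longleftrightarrow> h \<in> Homeo cantor_space \<and>
    (\<forall>U. open U \<longrightarrow> closed U \<longrightarrow> emeasure coin_measure (h -` U) = emeasure coin_measure U)"
proof (intro iffI conjI allI impI)
  fix U :: "(nat \<Rightarrow> bool) set" assume "h \<in> Aut_coin" "open U"
  then show "emeasure coin_measure (h -` U) = emeasure coin_measure U"
    by (intro Aut_coinD) (auto simp: sets_coin_measure)
next
  assume *: "h \<in> Homeo cantor_space \<and>
    (\<forall>U. open U \<longrightarrow> closed U \<longrightarrow> emeasure coin_measure (h -` U) = emeasure coin_measure U)"
  have h: "h \<in> coin_measure \<rightarrow>\<^sub>M coin_measure"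
    using * Homeo_cantor_spaceD(1) measurable_continuous_coin_measure by blast
  interpret prob_space coin_measure by (rule prob_space_coin_measure)
  have "distr coin_measure coin_measure h = coin_measure"
  proof (rule coin_measure_eqI)
    show "finite_measure (distr coin_measure coin_measure h)"
      by (rule finite_measure_distr[OF h])
    show "emeasure (distr coin_measure coin_measure h) U = emeasure coin_measure U"
      if "open U" "closed U" for U
      using * that by (subst emeasure_distr[OF h]) (auto simp: sets_coin_measure)
  qed auto
  then have "emeasure coin_measure (h -` A \<inter> space coin_measure) = emeasure coin_measure A"
    if "A \<in> sets coin_measure" for A
    using emeasure_distr[OF h that] by simp
  then show "h \<in> Aut_coin"
    using * by (auto simp: measure_automorphisms_def)
qed (auto simp: measure_automorphisms_def)

lemma subgroup_Aut_coin: "subgroup Aut_coin (homeo_group cantor_space)"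
proof -
  interpret G: group "homeo_group cantor_space" by (rule group_homeo_group)
  interpret B: group "BijGroup (topspace cantor_space)" by (rule group_BijGroup)
  have Bij: "h \<in> Bij UNIV" if "h \<in> Homeo cantor_space" for h
    using Homeo_cantor_spaceD(2)[OF that] by (simp add: Bij_def)
  have carrier: "carrier (homeo_group cantor_space) = Homeo cantor_space"
    by (simp add: homeo_group_def)
  have mult: "g \<otimes>\<^bsub>homeo_group cantor_space\<^esub> h = g \<circ> h"
    if "g \<in> Homeo cantor_space" "h \<in> Homeo cantor_space" for g h
    using Bij[OF that(1)] Bij[OF that(2)]
    by (auto simp: homeo_group_def BijGroup_def compose_def)
  \<comment> \<open>The inverse is computed in the full group of bijections and transferred to the
    subgroup of homeomorphisms.\<close>
  have inverse: "inv\<^bsub>homeo_group cantor_space\<^esub> h = inv_into UNIV h"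
    if "h \<in> Homeo cantor_space" for h
    using Bij[OF that] B.m_inv_consistent[OF subgroup_Homeo that]
      inv_BijGroup[of h "topspace cantor_space"]
    by (simp add: homeo_group_def restrict_UNIV)
  show ?thesis
  proof (rule G.subgroupI)
    show "Aut_coin \<subseteq> carrier (homeo_group cantor_space)"
      by (auto simp: carrier measure_automorphisms_def)
    have "id \<in> Aut_coin"
      by (auto simp: measure_automorphisms_def intro!: Homeo_cantor_spaceI[of id id])
    then show "Aut_coin \<noteq> {}" by blast
  next
    fix h assume h: "h \<in> Aut_coin"
    then have H: "h \<in> Homeo cantor_space" by (simp add: measure_automorphisms_def)
    have G: "inv_into UNIV h \<in> Homeo cantor_space"
      using G.inv_closed[of h] H by (simp add: carrier inverse)
    have "emeasure coin_measure (inv_into UNIV h -` A) = emeasure coin_measure A"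
      if A: "A \<in> sets coin_measure" for A
    proof -
      have "inv_into UNIV h -` A \<in> sets coin_measure"
        using measurable_sets[OF measurable_continuous_coin_measure A, of "inv_into UNIV h"]
          Homeo_cantor_spaceD(1)[OF G] by simp
      \<comment> \<open>Invariance under \<open>h\<close>, applied to the preimage of
        \<open>A\<close> under the inverse, is therefore invariance of \<open>A\<close> under the
        inverse.\<close>
      moreover have "h -` (inv_into UNIV h -` A) = A"
        using Homeo_cantor_spaceD(2)[OF H] by (auto simp: bij_is_inj inv_f_f)
      ultimately show ?thesis
        using Aut_coinD[OF h] by metis
    qed
    then show "inv\<^bsub>homeo_group cantor_space\<^esub> h \<in> Aut_coin"
      using G H by (simp add: inverse measure_automorphisms_def)
  next
    fix g h assume g: "g \<in> Aut_coin" and h: "h \<in> Aut_coin"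
    then have H: "g \<in> Homeo cantor_space" "h \<in> Homeo cantor_space"
      by (simp_all add: measure_automorphisms_def)
    have GH: "g \<circ> h \<in> Homeo cantor_space"
      using G.m_closed[of g h] H by (simp add: carrier mult)
    have "emeasure coin_measure ((g \<circ> h) -` A) = emeasure coin_measure A"
      if A: "A \<in> sets coin_measure" for A
    proof -
      have "g -` A \<in> sets coin_measure"
        using measurable_sets[OF measurable_continuous_coin_measure A, of g]
          Homeo_cantor_spaceD(1)[OF H(1)] by simp
      then show ?thesis
        using Aut_coinD[OF h] Aut_coinD[OF g A] by (simp add: vimage_comp[symmetric])
    qed
    then show "g \<otimes>\<^bsub>homeo_group cantor_space\<^esub> h \<in> Aut_coin"
      using GH H by (simp add: mult measure_automorphisms_def)
  qed
qed

lemma closedin_Aut_coin: "closedin (homeo_topology cantor_space) Aut_coin"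
proof -
  let ?T = "homeo_topology cantor_space"
  have sub: "Aut_coin \<subseteq> topspace ?T"
    by (auto simp: topspace_homeo_topology measure_automorphisms_def)
  have basic: "openin ?T {g \<in> Homeo cantor_space. g ` C \<subseteq> U}" if "closed C" "open U" for C U
  proof -
    have "compact_space cantor_space"
      by (simp add: cantor_space_def compact_space_product_topology compact_space_discrete_topology)
    then have "compactin cantor_space C"
      using that by (intro closedin_compact_space) (auto simp: cantor_space_eq_euclidean)
    then show ?thesis
      unfolding homeo_topology_def using that
      by (intro topology_generated_by_Basis) (auto simp: cantor_space_eq_euclidean)
  qed
  have "openin ?T (topspace ?T - Aut_coin)"
  proof (subst openin_subopen, intro ballI)
    fix h assume h: "h \<in> topspace ?T - Aut_coin"
    then have H: "h \<in> Homeo cantor_space" by (simp add: topspace_homeo_topology)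
    then obtain U where U: "open U" "closed U"
        "emeasure coin_measure (h -` U) \<noteq> emeasure coin_measure U"
      using h by (auto simp: Aut_coin_iff_clopen)
    \<comment> \<open>The maps \<open>g\<close> with the same preimage of the clopen set \<open>U\<close> form a neighbourhood of \<open>h\<close>.\<close>
    let ?N = "{g \<in> Homeo cantor_space. g ` (h -` U) \<subseteq> U} \<inter>
      {g \<in> Homeo cantor_space. g ` (h -` (- U)) \<subseteq> - U}"
    have "closed (h -` U)" "closed (h -` (- U))"
      using U Homeo_cantor_spaceD(1)[OF H]
      by (auto intro!: closed_vimage simp: closed_Compl)
    then have "openin ?T ?N"
      using U by (intro openin_Int basic) auto
    moreover have "h \<in> ?N" using H by auto
    moreover have "?N \<subseteq> topspace ?T - Aut_coin"
    proof
      fix g assume g: "g \<in> ?N"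
      then have "g -` U = h -` U" by (auto simp: image_subset_iff)
      then show "g \<in> topspace ?T - Aut_coin"
        using g U by (auto simp: topspace_homeo_topology Aut_coin_iff_clopen)
    qed
    ultimately show "\<exists>S. openin ?T S \<and> h \<in> S \<and> S \<subseteq> topspace ?T - Aut_coin"
      by blast
  qed
  then show ?thesis
    using sub by (simp add: closedin_def)
qed

section \<open>A homeomorphism that does not preserve the measure\<close>

lemma emeasure_coin_measure_cylinder:
  "emeasure coin_measure {x. \<forall>j<n. x j} = ennreal ((1/2) ^ n)"
proof -
  have E: "{x. \<forall>j<n. x j} =
      prod_emb UNIV (\<lambda>_. measure_pmf (bernoulli_pmf (1/2))) {..<n} ({..<n} \<rightarrow>\<^sub>E {True})"
    by (auto simp: prod_emb_def space_PiM fun_eq_iff restrict_def split: if_splits)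
  have "emeasure (measure_pmf (bernoulli_pmf (1/2))) {True} = ennreal (1/2)"
    by (subst emeasure_pmf_single) simp
  then have "emeasure coin_measure {x. \<forall>j<n. x j} = ennreal (1/2) ^ n"
    unfolding E coin_measure_def
    by (subst emeasure_PiM_emb) (auto intro: prob_space_measure_pmf)
  then show ?thesis
    by (simp only: ennreal_power)
qed

text \<open>A homeomorphism may carry the cylinder of prefix 11, of measure 1/4, onto the cylinder
  of prefix 1, of measure 1/2.\<close>

lemma Aut_coin_neq_Homeo: "Aut_coin \<noteq> Homeo cantor_space"
proof
  assume eq: "Aut_coin = Homeo cantor_space"
  \<comment> \<open>Writing \<open>1\<close> for \<open>True\<close>: \<open>h\<close> sends \<open>11z\<close> to \<open>1z\<close>, \<open>10z\<close> to \<open>01z\<close> and \<open>0z\<close> to \<open>00z\<close>.\<close>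
  define h :: "(nat \<Rightarrow> bool) \<Rightarrow> nat \<Rightarrow> bool" where
    "h = (\<lambda>x n. if x 0 then if x 1 then x (Suc n) else if n \<le> 1 then \<not> x n else x n
                else if n = 0 then False else x (n - 1))"
  \<comment> \<open>The inverse of \<open>h\<close>: it sends \<open>1z\<close> to
    \<open>11z\<close>, \<open>01z\<close> to \<open>10z\<close> and \<open>00z\<close> to
    \<open>0z\<close>.\<close>
  define g :: "(nat \<Rightarrow> bool) \<Rightarrow> nat \<Rightarrow> bool" where
    "g = (\<lambda>x n. if x 0 then if n = 0 then True else x (n - 1)
                else if x 1 then if n \<le> 1 then \<not> x n else x n else x (Suc n))"
  have "h \<in> Homeo cantor_space"
  proof (rule Homeo_cantor_spaceI)
    show "continuous_on UNIV h"
      \<comment> \<open>Coordinate \<open>n\<close> may depend on the coordinates 0, 1 and up to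
        \<open>n + 1\<close>, hence the bound \<open>n + 2\<close>.\<close>
      by (rule continuous_finitely_determined[where m = "\<lambda>n. n + 2"]) (simp add: h_def)
    show "continuous_on UNIV g"
      by (rule continuous_finitely_determined[where m = "\<lambda>n. n + 2"]) (simp add: g_def)
    show "g (h x) = x" for x
    proof
      show "g (h x) n = x n" for n
        by (cases n rule: nat.exhaust; cases "n = 1") (auto simp: g_def h_def)
    qed
    show "h (g x) = x" for x
    proof
      show "h (g x) n = x n" for n
        by (cases n rule: nat.exhaust; cases "n = 1") (auto simp: g_def h_def)
    qed
  qed
  then have h: "h \<in> Aut_coin" by (simp add: eq)
  have "open {x :: nat \<Rightarrow> bool. \<forall>j<1. x j}"
    by (rule open_finitely_determined[where m = 1]) auto
  then have "emeasure coin_measure (h -` {x. \<forall>j<1. x j}) = emeasure coin_measure {x. \<forall>j<1. x j}"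
    by (intro Aut_coinD[OF h]) (simp add: sets_coin_measure)
  moreover have "h -` {x. \<forall>j<1. x j} = {x. \<forall>j<2. x j}"
    by (auto simp: h_def less_2_cases_iff)
  ultimately have "ennreal ((1/2) ^ 2) = ennreal ((1/2) ^ 1)"
    by (simp only: emeasure_coin_measure_cylinder)
  then show False
    by (subst (asm) ennreal_inj) (auto simp: power2_eq_square)
qed

section \<open>Measure-preserving exchange of cylinders\<close>

text \<open>On booleans, \<noteq> is addition mod 2, so the map is translation by \<open>d\<close>.
  It acts coordinate by coordinate and preserves every factor, hence the product measure.\<close>

lemma emeasure_coin_measure_flip:
  assumes A: "A \<in> sets coin_measure"
  shows "emeasure coin_measure ((\<lambda>x i. x i \<noteq> d i) -` A) = emeasure coin_measure A"
proof -
  let ?f = "\<lambda>x i. x i \<noteq> d i"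
  let ?B = "measure_pmf (bernoulli_pmf (1/2))"
  have f: "?f \<in> coin_measure \<rightarrow>\<^sub>M coin_measure"
    by (rule measurable_continuous_coin_measure,
        rule continuous_finitely_determined[where m = Suc]) simp
  interpret product_prob_space "\<lambda>_. ?B" "UNIV :: nat set"
    by unfold_locales
  have "distr coin_measure coin_measure ?f = (\<Pi>\<^sub>M i\<in>UNIV. ?B)"
  proof (rule PiM_eq)
    fix J :: "nat set" and F :: "nat \<Rightarrow> bool set"
    assume J: "finite J"
    \<comment> \<open>Fairness enters here: negation turns a coin of bias \<open>p\<close> into one
      of bias \<open>1 - p\<close>.\<close>
    have "map_pmf (\<lambda>b. b \<noteq> c) (bernoulli_pmf (1/2)) = bernoulli_pmf (1/2)" for c
      by (rule pmf_eqI) (cases c; auto simp: map_pmf_def pmf_bind split: split_indicator)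
    then have B: "emeasure ?B ((\<lambda>b. b \<noteq> c) -` X) = emeasure ?B X" for c X
      by (metis emeasure_map_pmf)
    have "emeasure (distr coin_measure coin_measure ?f) (emb UNIV J (Pi\<^sub>E J F)) =
        emeasure coin_measure (?f -` emb UNIV J (Pi\<^sub>E J F))"
      using J by (subst emeasure_distr[OF f]) (auto simp: coin_measure_def space_PiM)
    also have "?f -` emb UNIV J (Pi\<^sub>E J F) = emb UNIV J (\<Pi>\<^sub>E j\<in>J. (\<lambda>b. b \<noteq> d j) -` F j)"
      by (auto simp: prod_emb_def space_PiM Pi_iff)
    also have "emeasure coin_measure \<dots> = (\<Prod>j\<in>J. emeasure ?B ((\<lambda>b. b \<noteq> d j) -` F j))"
      unfolding coin_measure_def using J by (intro emeasure_PiM_emb) auto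
    finally show "emeasure (distr coin_measure coin_measure ?f) (emb UNIV J (Pi\<^sub>E J F)) =
        (\<Prod>j\<in>J. emeasure ?B (F j))"
      by (simp only: B)
  qed (simp add: coin_measure_def)
  then show ?thesis
    using emeasure_distr[OF f A] by (simp flip: coin_measure_def)
qed

text \<open>A whole sequence \<open>s\<close> stands for its prefix of length \<open>m\<close>. Thus
  \<open>x \<in> cylinder m y\<close> is an equivalence relation between \<open>x\<close> and
  \<open>y\<close>: having the same prefix.\<close>

definition cylinder :: "nat \<Rightarrow> (nat \<Rightarrow> bool) \<Rightarrow> (nat \<Rightarrow> bool) set" where
  "cylinder m s = {x. \<forall>i<m. x i = s i}"

text \<open>Flipping the bits below \<open>m\<close> at which \<open>s\<close> and \<open>t\<close>
  differ exchanges their prefixes and keeps the tail. The map is the identity off the two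
  cylinders.\<close>

definition swap_cylinders ::
  "nat \<Rightarrow> (nat \<Rightarrow> bool) \<Rightarrow> (nat \<Rightarrow> bool) \<Rightarrow> (nat \<Rightarrow> bool) \<Rightarrow> nat \<Rightarrow> bool" where
  "swap_cylinders m s t x =
    (if x \<in> cylinder m s \<union> cylinder m t then \<lambda>i. x i \<noteq> (i < m \<and> s i \<noteq> t i) else x)"

lemma swap_cylinders_Un:
  "swap_cylinders m s t x \<in> cylinder m s \<union> cylinder m t \<longleftrightarrow> x \<in> cylinder m s \<union> cylinder m t"
  by (auto simp: swap_cylinders_def cylinder_def)

text \<open>The map is a continuous involution. It is a translation on the invariant set
  \<open>P\<close> and the identity elsewhere, and both pieces preserve the measure.\<close>

lemma swap_cylinders_in_Aut_coin: "swap_cylinders m s t \<in> Aut_coin"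
proof -
  let ?h = "swap_cylinders m s t"
  define P where "P = cylinder m s \<union> cylinder m t"
  define f :: "(nat \<Rightarrow> bool) \<Rightarrow> nat \<Rightarrow> bool"
    where "f = (\<lambda>x i. x i \<noteq> (i < m \<and> s i \<noteq> t i))"
  have flip: "f x \<in> P \<longleftrightarrow> x \<in> P" for x
  proof
    show "f x \<in> P" if "x \<in> P"
      using that by (auto simp: P_def f_def cylinder_def)
    then show "x \<in> P" if "f x \<in> P"
      using that by (auto simp: P_def f_def cylinder_def)
  qed
  have h: "?h x = (if x \<in> P then f x else x)" for x
    by (simp add: swap_cylinders_def P_def f_def)
  have inv: "?h (?h x) = x" for x
    by (auto simp: h flip) (auto simp: f_def)
  have "continuous_on UNIV ?h"
  \<comment> \<open>The first \<open>m\<close> coordinates decide membership in \<open>P\<close>,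
    and coordinate \<open>n\<close> gives the value.\<close>
  proof (rule continuous_finitely_determined[where m = "\<lambda>n. m + Suc n"])
    fix n and x y :: "nat \<Rightarrow> bool"
    assume eq: "\<And>i. i < m + Suc n \<Longrightarrow> y i = x i"
    then have "y \<in> P \<longleftrightarrow> x \<in> P" by (auto simp: P_def cylinder_def)
    then show "?h y n = ?h x n" using eq[of n] by (simp add: h f_def)
  qed
  then have H: "?h \<in> Homeo cantor_space"
    using inv by (intro Homeo_cantor_spaceI) auto
  have P: "P \<in> sets coin_measure"
    unfolding sets_coin_measure
    by (intro borel_open open_finitely_determined[where m = m]) (auto simp: P_def cylinder_def)
  have "emeasure coin_measure (?h -` A) = emeasure coin_measure A"
    if A: "A \<in> sets coin_measure" for A
  proof -
    let ?B = "f -` (A \<inter> P)"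
    have B: "?B \<in> sets coin_measure"
      using measurable_sets[OF measurable_continuous_coin_measure, of f "A \<inter> P"] A P
        continuous_finitely_determined[where f = f and m = Suc] by (simp add: f_def)
    \<comment> \<open>The preimage splits along \<open>P\<close>; invariance of \<open>P\<close>
      under \<open>f\<close> keeps the first piece inside \<open>P\<close>, so the two are
      disjoint.\<close>
    have "?h -` A = ?B \<union> (A - P)"
      unfolding vimage_Int using flip by (auto simp: h split: if_splits)
    moreover have "?B \<inter> (A - P) = {}"
      unfolding vimage_Int using flip by blast
    ultimately have "emeasure coin_measure (?h -` A) =
        emeasure coin_measure ?B + emeasure coin_measure (A - P)"
      using A P B by (simp add: plus_emeasure)
    also have "emeasure coin_measure ?B = emeasure coin_measure (A \<inter> P)"
      unfolding f_def using A P by (intro emeasure_coin_measure_flip) auto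
    also have "emeasure coin_measure (A \<inter> P) + emeasure coin_measure (A - P) =
        emeasure coin_measure A"
      using A P by (subst plus_emeasure) (auto intro: arg_cong[where f = "emeasure _"])
    finally show ?thesis .
  qed
  then show ?thesis
    using H by (simp add: measure_automorphisms_def)
qed

lemma swap_cylinders_left: "swap_cylinders m s t s \<in> cylinder m t"
  by (auto simp: swap_cylinders_def cylinder_def)

text \<open>The swap acts injectively on prefixes of length \<open>m\<close>: whether a point is
  moved depends only on its prefix, and a point and its image agree on membership in
  \<open>?P\<close>. So \<open>x\<close> and \<open>y\<close> are both flipped or both
  fixed.\<close>

lemma swap_cylinders_cylinder:
  assumes "swap_cylinders m s t x \<in> cylinder m (swap_cylinders m s t y)"
  shows "x \<in> cylinder m y"
proof -
  let ?P = "cylinder m s \<union> cylinder m t"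
  have "x \<in> ?P \<longleftrightarrow> swap_cylinders m s t x \<in> ?P" for x
    by (rule swap_cylinders_Un[symmetric])
  moreover have "u \<in> ?P \<longleftrightarrow> v \<in> ?P" if "u \<in> cylinder m v" for u v
    using that by (simp add: cylinder_def)
  ultimately have "x \<in> ?P \<longleftrightarrow> y \<in> ?P"
    using assms by blast
  then show ?thesis
    using assms by (auto simp only: swap_cylinders_def split: if_splits) (auto simp: cylinder_def)
qed

section \<open>Closed invariant sets of direct tuples\<close>

text \<open>Each pair of distinct sequences differs at some coordinate, and finitely many such
  coordinates have a common bound.\<close>

lemma finite_inj_separated_by_prefixes:
  fixes x :: "'i \<Rightarrow> nat \<Rightarrow> 'b"
  assumes "finite I" "inj_on x I"
  shows "\<exists>m0. \<forall>m\<ge>m0. \<forall>i\<in>I. \<forall>j\<in>I. (\<forall>k<m. x i k = x j k) \<longrightarrow> i = j"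
proof -
  have "\<exists>k. x i k \<noteq> x j k" if "i \<in> I" "j \<in> I" "i \<noteq> j" for i j
    using that assms(2) by (metis ext inj_onD)
  then obtain k where k: "\<And>i j. i \<in> I \<Longrightarrow> j \<in> I \<Longrightarrow> i \<noteq> j \<Longrightarrow> x i (k i j) \<noteq> x j (k i j)"
    by metis
  obtain m0 where m0: "\<And>i j. i \<in> I \<Longrightarrow> j \<in> I \<Longrightarrow> k i j < m0"
    using finite_nat_set_iff_bounded[of "case_prod k ` (I \<times> I)"] assms(1) by fastforce
  show ?thesis
    by (rule exI[of _ m0]) (meson k m0 less_le_trans)
qed

text \<open>The entries are moved one at a time: step \<open>k\<close> swaps the cylinders of
  \<open>z k\<close> and \<open>y k\<close>. This works because the prefixes within each tuple are
  pairwise distinct.\<close>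

lemma invariant_tuples_meet_cylinders:
  fixes x y :: "nat \<Rightarrow> nat \<Rightarrow> bool"
  assumes inv: "\<And>h z. h \<in> Aut_coin \<Longrightarrow> z \<in> R \<Longrightarrow> compose {..<n} h z \<in> R"
    and x: "x \<in> R" "\<And>i j. i < n \<Longrightarrow> j < n \<Longrightarrow> x i \<in> cylinder m (x j) \<Longrightarrow> i = j"
    and y: "\<And>i j. i < n \<Longrightarrow> j < n \<Longrightarrow> y i \<in> cylinder m (y j) \<Longrightarrow> i = j"
  shows "\<exists>z\<in>R. \<forall>i<n. z i \<in> cylinder m (y i)"
proof -
  \<comment> \<open>The induction must also carry distinctness of the prefixes of all
    \<open>n\<close> entries, including those not yet placed.\<close>
  have "\<exists>z\<in>R. (\<forall>i<k. z i \<in> cylinder m (y i)) \<and>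
      (\<forall>i<n. \<forall>j<n. z i \<in> cylinder m (z j) \<longrightarrow> i = j)" if "k \<le> n" for k
    using that
  proof (induction k)
    case 0
    then show ?case using x by auto
  next
    case (Suc k)
    then obtain z where z: "z \<in> R" "\<And>i. i < k \<Longrightarrow> z i \<in> cylinder m (y i)"
        "\<And>i j. i < n \<Longrightarrow> j < n \<Longrightarrow> z i \<in> cylinder m (z j) \<Longrightarrow> i = j"
      by auto
    let ?h = "swap_cylinders m (z k) (y k)"
    let ?z = "compose {..<n} ?h z"
    have eq: "?z i = ?h (z i)" if "i < n" for i
      using that by (simp add: compose_def)
    have "?z i \<in> cylinder m (y i)" if i: "i < Suc k" for i
    proof (cases "i = k")
      case True
      then show ?thesis using Suc.prems by (simp add: eq swap_cylinders_left)
    next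
      case False
      then have ik: "i < k" "i < n" "k < n" using i Suc.prems by auto
      \<comment> \<open>An entry already placed lies in neither swapped cylinder: its prefix is that
        of \<open>y i\<close>, which differs from those of \<open>z k\<close> and
        \<open>y k\<close>. So the swap fixes it.\<close>
      have "z i \<notin> cylinder m (z k)"
        using z(3) ik by blast
      moreover have "z i \<notin> cylinder m (y k)"
        using z(2)[OF ik(1)] y[of i k] ik by (auto simp: cylinder_def)
      ultimately show ?thesis
        using z(2)[OF ik(1)] ik by (simp add: eq swap_cylinders_def)
    qed
    moreover have "i = j" if "i < n" "j < n" "?z i \<in> cylinder m (?z j)" for i j
      using that z(3) swap_cylinders_cylinder by (metis eq)
    moreover have "?z \<in> R"
      using inv[OF swap_cylinders_in_Aut_coin z(1)] .
    ultimately show ?case by blast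
  qed
  from this[of n] show ?thesis by auto
qed

text \<open>If \<open>R\<close> contains some \<open>x\<close>, then every direct tuple
  \<open>y\<close> is a limit of tuples in \<open>R\<close> whose entries agree with those of
  \<open>y\<close> on longer and longer prefixes.\<close>

lemma closed_invariant_direct_tuples:
  assumes closed: "closedin (direct_tuple_topology n cantor_space) R"
    and inv: "\<And>h z. h \<in> Aut_coin \<Longrightarrow> z \<in> R \<Longrightarrow> compose {..<n} h z \<in> R"
  shows "R = {} \<or> R = direct_tuples n UNIV"
proof -
  have sub: "R \<subseteq> direct_tuples n UNIV"
    using closedin_subset[OF closed] by (auto simp: direct_tuple_topology_def)
  have "y \<in> R" if x: "x \<in> R" and y: "y \<in> direct_tuples n UNIV" for x y
  proof -
    have inj: "inj_on x {..<n}" "inj_on y {..<n}"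
      using x y sub by (auto simp: direct_tuples_def)
    obtain m1 where
      m1: "\<forall>m\<ge>m1. \<forall>i\<in>{..<n}. \<forall>j\<in>{..<n}. (\<forall>k<m. x i k = x j k) \<longrightarrow> i = j"
      using finite_inj_separated_by_prefixes[OF finite_lessThan inj(1)] ..
    obtain m2 where
      m2: "\<forall>m\<ge>m2. \<forall>i\<in>{..<n}. \<forall>j\<in>{..<n}. (\<forall>k<m. y i k = y j k) \<longrightarrow> i = j"
      using finite_inj_separated_by_prefixes[OF finite_lessThan inj(2)] ..
    have "\<exists>z\<in>R. \<forall>i<n. z i \<in> cylinder m (y i)" if "max m1 m2 \<le> m" for m
      using that m1 m2
      by (intro invariant_tuples_meet_cylinders[OF inv x]) (auto simp: cylinder_def)
    \<comment> \<open>A tuple is chosen for each length \<open>m\<close>. Below the separation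
      bounds it is arbitrary, so the facts that follow hold only eventually.\<close>
    then obtain z where z: "\<And>m. max m1 m2 \<le> m \<Longrightarrow> z m \<in> R"
        "\<And>m i. max m1 m2 \<le> m \<Longrightarrow> i < n \<Longrightarrow> z m i \<in> cylinder m (y i)"
      by metis
    have evR: "\<forall>\<^sub>F m in sequentially. z m \<in> R"
      using z(1) eventually_sequentially by blast
    have "(\<lambda>m. z m i) \<longlonglongrightarrow> y i" if "i < n" for i
    proof -
      \<comment> \<open>Coordinate \<open>k\<close> is settled once the prefix length exceeds
        \<open>k\<close>.\<close>
      have "\<forall>\<^sub>F m in sequentially. z m i k = y i k" for k
        using eventually_ge_at_top[of "max (max m1 m2) (Suc k)"]
        by eventually_elim (use z(2) that in \<open>auto simp: cylinder_def\<close>)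
      then have "(\<lambda>m. z m i k) \<longlonglongrightarrow> y i k" for k
        by (rule tendsto_eventually)
      then have "limitin (product_topology (\<lambda>_. euclidean) UNIV) (\<lambda>m. z m i) (y i) sequentially"
        by (simp add: limitin_componentwise)
      then show ?thesis
        by (simp add: euclidean_product_topology)
    qed
    moreover have tuples: "\<forall>\<^sub>F m in sequentially. z m \<in> direct_tuples n UNIV"
      using evR by (rule eventually_mono) (use sub in blast)
    moreover have "\<forall>\<^sub>F m in sequentially. z m \<in> {..<n} \<rightarrow>\<^sub>E UNIV"
      using tuples by (rule eventually_mono) (simp add: direct_tuples_def)
    moreover have "y \<in> extensional {..<n}"
      using y by (simp add: direct_tuples_def PiE_def)
    ultimately have "limitin (direct_tuple_topology n cantor_space) z y sequentially"
      using y
      by (simp add: direct_tuple_topology_def cantor_space_eq_euclidean limitin_subtopology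
          limitin_componentwise)
    then show "y \<in> R"
      using limitin_closedin[OF _ closed evR] by simp
  qed
  then show ?thesis using sub by blast
qed

section \<open>Automorphisms of purely direct structures\<close>

text \<open>The epimorphism condition concerns direct tuples only; injectivity of \<open>h\<close>
  ensures that the composite is one.\<close>

lemma compose_automorphism_interp:
  assumes h: "h \<in> automorphisms L A" and r: "r \<in> symbols L"
    and sub: "interp A r \<subseteq> direct_tuples (arity L r) (topspace (dom_top A))"
    and z: "z \<in> interp A r"
  shows "compose {..<arity L r} h z \<in> interp A r"
proof -
  have bij: "bij_betw h (topspace (dom_top A)) (topspace (dom_top A))"
    using h by (simp add: automorphisms_def)
  have "compose {..<arity L r} h z \<in> direct_tuples (arity L r) (topspace (dom_top A))"
    using z sub bij
    by (fastforce simp: direct_tuples_def compose_def bij_betw_def inj_on_def PiE_iff)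
  then show ?thesis
    using h r z unfolding automorphisms_def epimorphism_def by blast
qed

text \<open>An empty relation imposes nothing on a homeomorphism, and for a full relation every
  direct tuple lifts along the inverse.\<close>

lemma Homeo_subset_automorphisms:
  assumes dom: "dom_top A = cantor_space"
    and triv: "\<And>r. r \<in> symbols L \<Longrightarrow> interp A r = {} \<or> interp A r = direct_tuples (arity L r) UNIV"
  shows "Homeo cantor_space \<subseteq> automorphisms L A"
proof
  fix h assume h: "h \<in> Homeo cantor_space"
  note H = Homeo_cantor_spaceD[OF h]
  have "\<exists>\<alpha>\<in>direct_tuples n UNIV. \<beta> = compose {..<n} h \<alpha>" if "\<beta> \<in> direct_tuples n UNIV" for n \<beta>
  proof (rule bexI[of _ "compose {..<n} (inv_into UNIV h) \<beta>"])
    show "\<beta> = compose {..<n} h (compose {..<n} (inv_into UNIV h) \<beta>)"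
      using that H(2) by (auto simp: direct_tuples_def compose_def fun_eq_iff PiE_iff
          extensional_def bij_is_surj surj_f_inv_f)
    have "inj (inv_into UNIV h)" using H(2) by (simp add: bij_imp_bij_inv bij_is_inj)
    then show "compose {..<n} (inv_into UNIV h) \<beta> \<in> direct_tuples n UNIV"
      using that by (auto simp: direct_tuples_def compose_def inj_on_def)
  qed
  then have "\<beta> \<in> interp A r \<longleftrightarrow> (\<exists>\<alpha>\<in>interp A r. \<beta> = compose {..<arity L r} h \<alpha>)"
    if "r \<in> symbols L" "\<beta> \<in> direct_tuples (arity L r) UNIV" for r \<beta>
    using triv[OF that(1)] that(2) by auto
  then have "epimorphism L A A h"
    using H(1) bij_is_surj[OF H(2)]
    by (simp add: epimorphism_def dom cantor_space_eq_euclidean)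
  then show "h \<in> automorphisms L A"
    using H(2) by (simp add: automorphisms_def dom)
qed

theorem mainTheorem3:
  shows "subgroup (measure_automorphisms cantor_space coin_measure) (homeo_group cantor_space)
    \<and> closedin (homeo_topology cantor_space) (measure_automorphisms cantor_space coin_measure)
    \<and> measure_automorphisms cantor_space coin_measure \<noteq> Homeo cantor_space
    \<and> \<not> (\<exists>(L :: 'r lang) (A :: ('r, nat \<Rightarrow> bool) top_struct).
          purely_direct_lang L \<and> purely_direct_struct L A \<and> dom_top A = cantor_space \<and>
          automorphisms L A = measure_automorphisms cantor_space coin_measure)"
proof (intro conjI, fact subgroup_Aut_coin, fact closedin_Aut_coin, fact Aut_coin_neq_Homeo,
    rule notI)
  assume "\<exists>(L :: 'r lang) (A :: ('r, nat \<Rightarrow> bool) top_struct).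
          purely_direct_lang L \<and> purely_direct_struct L A \<and> dom_top A = cantor_space \<and>
          automorphisms L A = Aut_coin"
  then obtain L :: "'r lang" and A :: "('r, nat \<Rightarrow> bool) top_struct"
    where struct: "purely_direct_struct L A" and dom: "dom_top A = cantor_space"
      and aut: "automorphisms L A = Aut_coin"
    by blast
  \<comment> \<open>The inclusion of \<open>Aut_coin\<close> in the automorphisms makes every
    relation invariant.\<close>
  have "interp A r = {} \<or> interp A r = direct_tuples (arity L r) UNIV" if r: "r \<in> symbols L" for r
  proof (rule closed_invariant_direct_tuples)
    show closed: "closedin (direct_tuple_topology (arity L r) cantor_space) (interp A r)"
      using struct r dom by (auto simp: purely_direct_struct_def)
    have "interp A r \<subseteq> direct_tuples (arity L r) (topspace (dom_top A))"
      using closedin_subset[OF closed] dom by (auto simp: direct_tuple_topology_def)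
    then show "compose {..<arity L r} h z \<in> interp A r" if "h \<in> Aut_coin" "z \<in> interp A r" for h z
      using compose_automorphism_interp[of h L A r z] that r aut by simp
  qed
  \<comment> \<open>The opposite inclusion now forces every homeomorphism to preserve the
    measure.\<close>
  then have "Homeo cantor_space \<subseteq> Aut_coin"
    using Homeo_subset_automorphisms[OF dom] aut by blast
  then show False
    using Aut_coin_neq_Homeo by (auto simp: measure_automorphisms_def)
qed

end
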